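(* The following two items hold: (1) For every integer $n>2$, if $n$ is $2$-practical, then the ring $\mathbb{M}_n(\mathbb{F}_2)$ is almost $n$-torsion clean. (2) The converse fails in general: there exists an integer $n>2$ such that $\mathbb{M}_n(\mathbb{F}_2)$ is almost $n$-torsion clean but $n$ is not $2$-practical.
   Context: $\mathbb{F}_2$ is the field with two elements and $\mathbb{M}_n(\mathbb{F}_2)$ is the ring of all $n\times n$ matrices over $\mathbb{F}_2$. For a prime $p$, a positive integer $n$ is called $p$-practical if the polynomial $X^n-1$ over the field $\mathbb{F}_p$ with $p$ elements has divisors in $\mathbb{F}_p[X]$ of every degree less than or equal to $n$. For a positive integer $m$, a ring $R$ with identity $1\neq 0$ is called almost $m$-torsion clean if for every $r\in R$ there exist a unit $u\in R$ with $u^m=1$ and an idempotent $e\in R$ (i.e. $e^2=e$) such that $r=u+e$. *)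

theory Defs
  imports
    "Jordan_Normal_Form.Matrix"
    "Berlekamp_Zassenhaus.Finite_Field"
    "HOL-Computational_Algebra.Polynomial"
begin

text \<open>For a type of prime cardinality \<open>p\<close>, \<open>mod_ring\<close> over that type is the field of integers
  modulo \<open>p\<close>. Since \<open>bool\<close> has two elements, \<open>bool mod_ring\<close> is the field with two elements.\<close>

type_synonym F2 = "bool mod_ring"

text \<open>The prime \<open>p\<close> is \<open>CARD('p)\<close>. As \<open>n > 0\<close>, the polynomial \<open>X ^ n - 1\<close> is nonzero, hence so are
  its divisors, and the convention \<open>degree 0 = 0\<close> does not interfere.\<close>

definition p_practical :: "'p::prime_card itself \<Rightarrow> nat \<Rightarrow> bool" where
  "p_practical TYPE('p) n \<longleftrightarrow>
     n > 0 \<and>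
     (\<forall>d\<le>n. \<exists>f :: 'p mod_ring poly. f dvd monom 1 n - 1 \<and> degree f = d)"

definition almost_torsion_clean :: "nat \<Rightarrow> ('a, 'b) ring_scheme \<Rightarrow> bool" where
  "almost_torsion_clean m R \<longleftrightarrow>
     m > 0 \<and> ring R \<and> \<one>\<^bsub>R\<^esub> \<noteq> \<zero>\<^bsub>R\<^esub> \<and>
     (\<forall>r \<in> carrier R. \<exists>u \<in> Units R. \<exists>e \<in> carrier R.
        u [^]\<^bsub>R\<^esub> m = \<one>\<^bsub>R\<^esub> \<and> e \<otimes>\<^bsub>R\<^esub> e = e \<and> r = u \<oplus>\<^bsub>R\<^esub> e)"

end

theory Submission
  imports
    Defs
    "Jordan_Normal_Form.Determinant"
    "Berlekamp_Zassenhaus.Distinct_Degree_Factorization"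
begin

text \<open>
  Call a square matrix \<open>A\<close> \<open>m\<close>-power clean if \<open>A = U + E\<close> with \<open>U\<^sup>m = 1\<close> and \<open>E\<close> idempotent. This
  property is invariant under similarity and transposition and passes to direct sums of blocks.
  Every matrix over a field is similar to a direct sum of companion matrices, so it is enough to
  treat companion matrices of size at most \<open>n\<close> (\<open>power_clean_if_companions\<close>). The reduction
  needs less than the rational canonical form: some companion block can be split off \<open>A\<close> or its
  transpose, and induction on the size takes care of the complement. The block is found by
  maximality. Among all vectors and all functionals, take one that generates the cyclic subspace
  of largest dimension \<open>d\<close>; by passing to the transpose it may be taken to be a vector. A functional
  that detects the last basis vector of this subspace generates at most \<open>d\<close> dimensions, and the
  annihilator of what it generates is an invariant complement.

  For the first part, let \<open>f\<close> of degree \<open>d\<close> divide \<open>X\<^sup>n - 1\<close> over the field with two elements. The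
  companion matrix of \<open>f\<close>, and everything similar to it, has \<open>n\<close>-th power \<open>1\<close>. Given a companion
  matrix \<open>C\<close> of size \<open>d\<close>, compare traces. If the trace of \<open>C\<close> is not that of \<open>f\<close>, then \<open>C\<close>
  differs from the companion matrix of \<open>f\<close> by a matrix that lives in the last column and has
  corner entry \<open>1\<close>, an idempotent of rank one. If the traces agree and \<open>d \<ge> 3\<close>, an idempotent of rank
  two, living in the last two columns, has enough free entries to move the characteristic
  polynomial of \<open>C\<close> to \<open>f\<close> (\<open>power_clean_companion_equal_trace\<close>). Sizes one and two are checked by
  hand.

  For the second part, every matrix over the field with two elements, of any size, is in fact
  \<open>16\<close>-power clean. Small companion matrices are covered by the divisors \<open>(X + 1)\<^sup>d\<close> of
  \<open>X\<^sup>1\<^sup>6 - 1 = (X + 1)\<^sup>1\<^sup>6\<close>. A large one is cut into diagonal pieces of size three and one last piece of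
  size at most seven, whose size is chosen so that its trace comes out right
  (\<open>power_clean_16_companion\<close>). Hence matrices of size \<open>304 = 16 * 19\<close> are \<open>304\<close>-power clean. But
  \<open>X\<^sup>3\<^sup>0\<^sup>4 - 1 = (X + 1)\<^sup>1\<^sup>6 \<Psi>\<^sup>1\<^sup>6\<close> for the nineteenth cyclotomic polynomial \<open>\<Psi>\<close>, which is irreducible of
  degree \<open>18\<close> because \<open>2\<close> is a primitive root modulo \<open>19\<close>; so there is no divisor of degree \<open>17\<close>.
\<close>

section \<open>Sums of a root of unity and an idempotent\<close>

definition power_clean :: "nat \<Rightarrow> 'a :: comm_ring_1 mat \<Rightarrow> bool" where
  "power_clean m A \<longleftrightarrow> (\<exists>U E. U \<in> carrier_mat (dim_row A) (dim_row A)
     \<and> E \<in> carrier_mat (dim_row A) (dim_row A) \<and> U ^\<^sub>m m = 1\<^sub>m (dim_row A) \<and> E * E = E \<and> A = U + E)"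

lemma power_cleanI:
  assumes "U \<in> carrier_mat n n" "E \<in> carrier_mat n n" "U ^\<^sub>m m = 1\<^sub>m n" "E * E = E" "A = U + E"
  shows "power_clean m A"
  using assms unfolding power_clean_def by auto

lemma power_cleanE:
  assumes "power_clean m A" "A \<in> carrier_mat n n"
  obtains U E where "U \<in> carrier_mat n n" "E \<in> carrier_mat n n" "U ^\<^sub>m m = 1\<^sub>m n" "E * E = E" "A = U + E"
  using assms unfolding power_clean_def by auto

lemma power_clean_similar:
  fixes A :: "'a :: comm_ring_1 mat"
  assumes "similar_mat A B" "power_clean m B"
  shows "power_clean m A"
proof -
  obtain P Q where "similar_mat_wit A B P Q" using assms(1) unfolding similar_mat_def by blast
  define n where "n = dim_row A"
  note w = similar_mat_witD[OF n_def \<open>similar_mat_wit A B P Q\<close>]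
  obtain U E where UE: "U \<in> carrier_mat n n" "E \<in> carrier_mat n n" "U ^\<^sub>m m = 1\<^sub>m n" "E * E = E" "B = U + E"
    using power_cleanE[OF assms(2) w(5)] by blast
  have c: "P * U * Q \<in> carrier_mat n n" "P * E * Q \<in> carrier_mat n n" using w UE by auto
  have wit: "similar_mat_wit (P * U * Q) U P Q"
    by (rule similar_mat_witI[OF w(1,2) refl c(1) UE(1) w(6,7)])
  show ?thesis
  proof (rule power_cleanI[OF c])
    show "(P * U * Q) ^\<^sub>m m = 1\<^sub>m n"
      using similar_mat_wit_pow_id[OF wit, of m] UE w by simp
    have "P * E * Q * (P * E * Q) = P * (E * (Q * P) * E) * Q"
      using w(6,7) UE(2) by (simp add: assoc_mult_mat[of _ n n _ n _ n])
    also have "\<dots> = P * E * Q" unfolding w(2) using UE by simp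
    finally show "P * E * Q * (P * E * Q) = P * E * Q" .
    show "A = P * U * Q + P * E * Q"
      unfolding w(3) UE(5) using w UE
      by (simp add: mult_add_distrib_mat[of _ n n _ n] add_mult_distrib_mat[of _ n n _ _ n])
  qed
qed

lemma pow_mat_Suc_left:
  assumes "A \<in> carrier_mat n n"
  shows "A ^\<^sub>m Suc k = A * A ^\<^sub>m k"
proof (induction k)
  case (Suc k)
  have "A ^\<^sub>m Suc (Suc k) = A * A ^\<^sub>m k * A" using Suc by simp
  thus ?case using assms by (simp add: assoc_mult_mat[of _ n n _ n _ n])
qed (use assms in auto)

lemma transpose_pow_mat:
  fixes A :: "'a :: comm_semiring_1 mat"
  assumes "A \<in> carrier_mat n n"
  shows "transpose_mat (A ^\<^sub>m k) = transpose_mat A ^\<^sub>m k"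
proof (induction k)
  case (Suc k)
  have "transpose_mat (A ^\<^sub>m Suc k) = transpose_mat A * transpose_mat (A ^\<^sub>m k)"
    using assms by (simp add: transpose_mult[of _ n n _ n])
  also have "\<dots> = transpose_mat A ^\<^sub>m Suc k"
    unfolding Suc using assms by (subst pow_mat_Suc_left[of _ n]) auto
  finally show ?case .
qed (use assms in auto)

lemma power_clean_transpose:
  fixes A :: "'a :: comm_ring_1 mat"
  assumes "A \<in> carrier_mat n n" "power_clean m A"
  shows "power_clean m (transpose_mat A)"
proof -
  obtain U E where UE: "U \<in> carrier_mat n n" "E \<in> carrier_mat n n" "U ^\<^sub>m m = 1\<^sub>m n" "E * E = E" "A = U + E"
    using power_cleanE[OF assms(2,1)] by blast
  show ?thesis
  proof (rule power_cleanI)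
    show "transpose_mat U ^\<^sub>m m = 1\<^sub>m n" using UE transpose_pow_mat[of U n m] by simp
    show "transpose_mat E * transpose_mat E = transpose_mat E"
      using UE transpose_mult[of E n n E n] by simp
    show "transpose_mat A = transpose_mat U + transpose_mat E"
      using UE transpose_add by metis
  qed (use UE in auto)
qed

lemma power_clean_block_diag:
  fixes A :: "'a :: comm_ring_1 mat"
  assumes A: "A \<in> carrier_mat k k" "power_clean m A" and B: "B \<in> carrier_mat l l" "power_clean m B"
  shows "power_clean m (four_block_mat A (0\<^sub>m k l) (0\<^sub>m l k) B)"
proof -
  obtain U E where UE: "U \<in> carrier_mat k k" "E \<in> carrier_mat k k" "U ^\<^sub>m m = 1\<^sub>m k" "E * E = E" "A = U + E"
    using power_cleanE[OF A(2,1)] by blast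
  obtain V F where VF: "V \<in> carrier_mat l l" "F \<in> carrier_mat l l" "V ^\<^sub>m m = 1\<^sub>m l" "F * F = F" "B = V + F"
    using power_cleanE[OF B(2,1)] by blast
  show ?thesis
  proof (rule power_cleanI)
    let ?U = "four_block_mat U (0\<^sub>m k l) (0\<^sub>m l k) V"
    let ?E = "four_block_mat E (0\<^sub>m k l) (0\<^sub>m l k) F"
    show "?U \<in> carrier_mat (k + l) (k + l)" "?E \<in> carrier_mat (k + l) (k + l)" using UE VF by auto
    show "?U ^\<^sub>m m = 1\<^sub>m (k + l)" using UE VF by (simp add: pow_four_block_mat)
    show "?E * ?E = ?E" using UE VF by (subst mult_four_block_mat[of _ k k _ l _ l _ _ k _ l]) auto
    show "four_block_mat A (0\<^sub>m k l) (0\<^sub>m l k) B = ?U + ?E"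
      using UE VF by (subst add_four_block_mat[of _ k k _ l _ l]) auto
  qed
qed

section \<open>Splitting off companion blocks\<close>

text \<open>
  In \<open>shift_form d A\<close> the first \<open>d\<close> unit vectors are a chain: \<open>A\<close> maps each of them to the next one,
  and nothing is said about the image of the last. Up to similarity, this expresses that some
  vector \<open>v\<close> has linearly independent iterates \<open>v, A v, \<dots>, A ^ (d - 1) v\<close> without mentioning linear
  independence.
\<close>

definition shift_form :: "nat \<Rightarrow> 'a :: zero_neq_one mat \<Rightarrow> bool" where
  "shift_form d A \<longleftrightarrow> d \<le> dim_row A
     \<and> (\<forall>i j. i < dim_row A \<longrightarrow> Suc j < d \<longrightarrow> A $$ (i, j) = (if i = Suc j then 1 else 0))"

text \<open>
  The argument \<open>c\<close> lists the last column, so for \<open>d > 0\<close> this is the companion matrix of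
  \<open>X\<^sup>d - \<Sum> c\<^sub>i X\<^sup>i\<close>, with trace \<open>c (d - 1)\<close>.
\<close>

definition companion :: "nat \<Rightarrow> (nat \<Rightarrow> 'a :: zero_neq_one) \<Rightarrow> 'a mat" where
  "companion d c = mat d d (\<lambda>(i, j). if Suc j = d then c i else if i = Suc j then 1 else 0)"

lemma companion_carrier[simp]: "companion d c \<in> carrier_mat d d"
  by (simp add: companion_def)

lemma invertible_if_trivial_kernel:
  fixes S :: "'a :: field mat"
  assumes S: "S \<in> carrier_mat n n"
    and ker: "\<And>x. x \<in> carrier_vec n \<Longrightarrow> S *\<^sub>v x = 0\<^sub>v n \<Longrightarrow> x = 0\<^sub>v n"
  obtains T where "T \<in> carrier_mat n n" "T * S = 1\<^sub>m n" "S * T = 1\<^sub>m n"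
proof -
  have "det S \<noteq> 0" using det_0_iff_vec_prod_zero_field[OF S] ker by blast
  from det_non_zero_imp_unit[OF S this, of "()"] show ?thesis
    using that unfolding Units_def ring_mat_simps by auto
qed

lemma mult_unit_vec:
  fixes A :: "'a :: comm_ring_1 mat"
  assumes "A \<in> carrier_mat n m" "j < m"
  shows "A *\<^sub>v unit_vec m j = col A j"
  using assms by (intro eq_vecI) auto

lemma shift_form_conjugate:
  fixes A :: "'a :: field mat"
  assumes carr: "A \<in> carrier_mat n n" "S \<in> carrier_mat n n" "T \<in> carrier_mat n n"
    and inv: "T * S = 1\<^sub>m n" and d: "d \<le> n"
    and step: "\<And>j. Suc j < d \<Longrightarrow> A *\<^sub>v col S j = col S (Suc j)"
  shows "shift_form d (T * A * S)"
  unfolding shift_form_def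
proof (intro conjI allI impI)
  show "d \<le> dim_row (T * A * S)" using carr d by simp
  fix i j assume i: "i < dim_row (T * A * S)" and j: "Suc j < d"
  have [simp]: "i < n" "j < n" "Suc j < n" using i j carr d by auto
  have "col (T * A * S) j = T *\<^sub>v (A *\<^sub>v col S j)"
    using carr by (simp add: col_mult2[of _ n n _ n] assoc_mult_mat_vec[of _ n n _ n] del: col_mult)
  also have "\<dots> = col (T * S) (Suc j)"
    unfolding step[OF j] using carr by (simp add: col_mult2[of _ n n _ n] del: col_mult)
  finally have "col (T * A * S) j = unit_vec n (Suc j)" by (simp add: inv)
  hence "col (T * A * S) j $ i = (if i = Suc j then 1 else 0)" by simp
  thus "(T * A * S) $$ (i, j) = (if i = Suc j then 1 else 0)" using carr by simp
qed

text \<open>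
  If the image \<open>w\<close> of the last vector of the chain leaves the span of the chain, then \<open>w\<close> can be
  made the next basis vector. The change of basis replaces \<open>e\<^sub>d\<close> by \<open>w\<close>, and, to keep a basis, \<open>e\<^sub>i\<close> by
  \<open>e\<^sub>d\<close>, where \<open>i\<close> is a coordinate in which \<open>w\<close> does not vanish.
\<close>

lemma shift_form_extend:
  fixes A :: "'a :: field mat"
  assumes A: "A \<in> carrier_mat n n" and sf: "shift_form d A"
    and d: "d > 0" and i: "d \<le> i" "i < n" "A $$ (i, d - 1) \<noteq> 0"
  obtains B where "similar_mat B A" "B \<in> carrier_mat n n" "shift_form (Suc d) B"
proof -
  define w where "w r = A $$ (r, d - 1)" for r
  define S where "S = mat n n (\<lambda>(r, j). if j = d then w r
     else if j = i then (if r = d then 1 else 0) else if r = j then 1 else 0)"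
  have S: "S \<in> carrier_mat n n" by (simp add: S_def)
  have Sx: "(S *\<^sub>v x) $ r = w r * x $ d +
      (if r = d then (if i = d then 0 else x $ i) else if r = i then 0 else x $ r)"
    if x: "x \<in> carrier_vec n" and r: "r < n" for x r
  proof -
    have "(S *\<^sub>v x) $ r = (\<Sum>j = 0..<n. S $$ (r, j) * x $ j)"
      using S x r by (simp add: scalar_prod_def)
    also have "\<dots> = (\<Sum>j = 0..<n. (if j = d then w r * x $ d else 0) +
        (if j = (if r = d then i else r) then
           (if r = d then (if i = d then 0 else x $ i) else if r = i then 0 else x $ r) else 0))"
      by (rule sum.cong[OF refl]) (use r i in \<open>auto simp: S_def\<close>)
    also have "\<dots> = w r * x $ d +
      (if r = d then (if i = d then 0 else x $ i) else if r = i then 0 else x $ r)"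
      unfolding sum.distrib using i r by (auto simp: sum.delta)
    finally show ?thesis .
  qed
  obtain T where T: "T \<in> carrier_mat n n" "T * S = 1\<^sub>m n" "S * T = 1\<^sub>m n"
  proof (rule invertible_if_trivial_kernel[OF S])
    fix x assume x: "x \<in> carrier_vec n" and 0: "S *\<^sub>v x = 0\<^sub>v n"
    have eq: "w r * x $ d +
      (if r = d then (if i = d then 0 else x $ i) else if r = i then 0 else x $ r) = 0" if "r < n" for r
      using Sx[OF x that] that by (simp add: 0)
    have xd: "x $ d = 0"
      using eq[of i] i by (auto simp: w_def split: if_splits)
    have "x $ r = 0" if r: "r < n" for r
    proof (cases "r = i")
      case True thus ?thesis using eq[of d] xd i by (auto split: if_splits)
    next
      case False thus ?thesis using eq[of r] xd i r by (auto split: if_splits)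
    qed
    thus "x = 0\<^sub>v n" using x by (intro eq_vecI) auto
  qed
  have colS: "col S j = unit_vec n j" if "j < d" for j
    using that i by (intro eq_vecI) (auto simp: S_def)
  have Acol: "A *\<^sub>v unit_vec n j = col A j" if "j < n" for j
    using mult_unit_vec[OF A that] .
  have "shift_form (Suc d) (T * A * S)"
  proof (rule shift_form_conjugate[OF A S T(1,2)])
    fix j assume "Suc j < Suc d"
    hence j: "j < d" by simp
    have "A *\<^sub>v col S j = col A j" using colS[OF j] Acol j i by simp
    also have "\<dots> = col S (Suc j)"
    proof (cases "Suc j = d")
      case True
      have "col S d = col A (d - 1)" using A i by (intro eq_vecI) (auto simp: S_def w_def)
      thus ?thesis using True by auto
    next
      case False
      hence "Suc j < d" using j by simp
      thus ?thesis using sf A i colS[of "Suc j"] j unfolding shift_form_def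
        by (intro eq_vecI) auto
    qed
    finally show "A *\<^sub>v col S j = col S (Suc j)" .
  qed (use i in auto)
  moreover have "similar_mat (T * A * S) A"
    by (rule similar_matI[of _ _ T S n]) (use A S T in auto)
  moreover have "T * A * S \<in> carrier_mat n n" using A S T by auto
  ultimately show ?thesis using that by blast
qed

text \<open>
  Suppose that the chain spans an invariant subspace, and apply the transpose repeatedly to
  \<open>e\<^bsub>d-1\<^esub>\<close>. Restricted to the first \<open>d\<close> coordinates, the first \<open>d\<close> iterates form an
  anti-triangular matrix with ones on the antidiagonal. So together with the remaining unit vectors
  they are a basis, in which the transpose has a chain again. The remaining unit vectors span an
  invariant subspace of the transpose, whence the zero block in the upper right.
\<close>

lemma shift_form_dual:
  fixes A :: "'a :: field mat"
  assumes A: "A \<in> carrier_mat n n" and sf: "shift_form d A"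
    and d: "d > 0" and low: "\<And>i j. d \<le> i \<Longrightarrow> i < n \<Longrightarrow> j < d \<Longrightarrow> A $$ (i, j) = 0"
  obtains B where "similar_mat B (transpose_mat A)" "B \<in> carrier_mat n n" "shift_form d B"
    "\<And>i j. i < d \<Longrightarrow> d \<le> j \<Longrightarrow> j < n \<Longrightarrow> B $$ (i, j) = 0"
proof -
  let ?A = "transpose_mat A"
  have dn: "d \<le> n" using sf A by (simp add: shift_form_def)
  have A': "?A \<in> carrier_mat n n" using A by simp
  define x where "x j = ((\<lambda>v. ?A *\<^sub>v v) ^^ j) (unit_vec n (d - 1))" for j
  have xc: "x j \<in> carrier_vec n" for j
  proof (induction j)
    case (Suc j)
    show ?case using A by (auto simp: x_def intro!: carrier_vecI)
  qed (simp add: x_def)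
  have xSuc: "x (Suc j) = ?A *\<^sub>v x j" for j by (simp add: x_def)
  \<comment> \<open>one application of the transpose moves the entries of a vector up by one place\<close>
  have up: "x (Suc j) $ i = x j $ Suc i" if "Suc i < d" for i j
  proof -
    have "x (Suc j) $ i = (\<Sum>r = 0..<n. A $$ (r, i) * x j $ r)"
      unfolding xSuc using A that dn xc[of j] by (simp add: scalar_prod_def)
    also have "\<dots> = (\<Sum>r = 0..<n. if r = Suc i then x j $ Suc i else 0)"
      by (rule sum.cong[OF refl]) (use sf A that in \<open>auto simp: shift_form_def\<close>)
    finally show ?thesis using that dn by simp
  qed
  have anti: "i + j < d \<Longrightarrow> x j $ i = (if i + j = d - 1 then 1 else 0)" for i j
  proof (induction j arbitrary: i)
    case 0 thus ?case using dn by (auto simp: x_def)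
  next
    case (Suc j)
    show ?case using up[of i j] Suc.IH[of "Suc i"] Suc.prems by auto
  qed
  define S where "S = mat n n (\<lambda>(i, j). if j < d then x j $ i else if i = j then 1 else 0)"
  have S: "S \<in> carrier_mat n n" by (simp add: S_def)
  have colx: "col S j = x j" if "j < d" for j
    using that dn xc[of j] by (intro eq_vecI) (auto simp: S_def)
  have colu: "col S j = unit_vec n j" if "d \<le> j" "j < n" for j
    using that by (intro eq_vecI) (auto simp: S_def)
  obtain T' where T': "T' \<in> carrier_mat n n" "T' * transpose_mat S = 1\<^sub>m n" "transpose_mat S * T' = 1\<^sub>m n"
  proof (rule invertible_if_trivial_kernel)
    show "transpose_mat S \<in> carrier_mat n n" using S by simp
    fix y assume y: "y \<in> carrier_vec n" and 0: "transpose_mat S *\<^sub>v y = 0\<^sub>v n"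
    have dot: "(\<Sum>i = 0..<n. S $$ (i, j) * y $ i) = 0" if "j < n" for j
    proof -
      have "(transpose_mat S *\<^sub>v y) $ j = (\<Sum>i = 0..<n. S $$ (i, j) * y $ i)"
        using S y that by (simp add: scalar_prod_def)
      thus ?thesis using 0 that by simp
    qed
    have high: "y $ j = 0" if "d \<le> j" "j < n" for j
    proof -
      have "(\<Sum>i = 0..<n. S $$ (i, j) * y $ i) = (\<Sum>i = 0..<n. if i = j then y $ j else 0)"
        by (rule sum.cong[OF refl]) (use that in \<open>auto simp: S_def\<close>)
      thus ?thesis using dot[of j] that by simp
    qed
    have low: "j < d \<Longrightarrow> y $ (d - 1 - j) = 0" for j
    proof (induction j rule: less_induct)
      case (less j)
      have "(\<Sum>i = 0..<n. S $$ (i, j) * y $ i) = (\<Sum>i = 0..<n. if i = d - 1 - j then y $ (d - 1 - j) else 0)"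
      proof (rule sum.cong[OF refl])
        fix i assume i: "i \<in> {0..<n}"
        consider "d \<le> i" | "i < d" "i > d - 1 - j" | "i < d" "i \<le> d - 1 - j" by linarith
        thus "S $$ (i, j) * y $ i = (if i = d - 1 - j then y $ (d - 1 - j) else 0)"
        proof cases
          case 1 thus ?thesis using high[of i] i less.prems by auto
        next
          case 2
          hence "y $ (d - 1 - (d - 1 - i)) = 0" using less.IH[of "d - 1 - i"] less.prems by linarith
          thus ?thesis using 2 by simp
        next
          case 3 thus ?thesis using anti[of i j] i less.prems dn by (auto simp: S_def)
        qed
      qed
      thus ?case using dot[of j] less.prems dn by (simp split: if_splits)
    qed
    have "y $ i = 0" if "i < n" for i
      using high[of i] low[of "d - 1 - i"] that by (cases "i < d") auto
    thus "y = 0\<^sub>v n" using y by (intro eq_vecI) auto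
  qed
  define T where "T = transpose_mat T'"
  have T: "T \<in> carrier_mat n n" using T' by (simp add: T_def)
  have ST: "S * T = 1\<^sub>m n"
    using transpose_mult[OF T'(1), of "transpose_mat S" n] T'(2) S by (simp add: T_def)
  have TS: "T * S = 1\<^sub>m n" using mat_mult_left_right_inverse[OF S T ST] .
  let ?B = "T * ?A * S"
  have "similar_mat ?B ?A"
    by (rule similar_matI[of _ _ T S n]) (use A' S T TS ST in auto)
  moreover have "?B \<in> carrier_mat n n" using A' S T by auto
  moreover have "shift_form d ?B"
    by (rule shift_form_conjugate[OF A' S T TS dn]) (auto simp: colx xSuc)
  moreover have "?B $$ (i, j) = 0" if ij: "i < d" "d \<le> j" "j < n" for i j
  proof -
    \<comment> \<open>the transpose maps \<open>e\<^sub>j\<close> into the span of the unit vectors from \<open>d\<close> on, which \<open>S\<close> fixes\<close>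
    let ?v = "row A j"
    have v: "?v \<in> carrier_vec n" using A by (auto intro!: carrier_vecI)
    have v0: "?v $ r = 0" if "r < d" for r using that low[of j r] ij A dn by simp
    have "S *\<^sub>v ?v = ?v"
    proof (rule eq_vecI)
      fix r assume r: "r < dim_vec ?v"
      have "(S *\<^sub>v ?v) $ r = (\<Sum>k = 0..<n. S $$ (r, k) * ?v $ k)"
        using S A v r ij by (simp add: scalar_prod_def)
      also have "\<dots> = (\<Sum>k = 0..<n. if k = r then ?v $ r else 0)"
      proof (rule sum.cong[OF refl])
        fix k assume "k \<in> {0..<n}"
        thus "S $$ (r, k) * ?v $ k = (if k = r then ?v $ r else 0)"
          using v0[of k] r A by (cases "k < d") (auto simp: S_def)
      qed
      finally show "(S *\<^sub>v ?v) $ r = ?v $ r" using r A by simp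
    qed (use S A in simp)
    hence Tv: "T *\<^sub>v ?v = ?v" using S T TS v by (metis assoc_mult_mat_vec one_mult_mat_vec)
    have "col ?B j = T *\<^sub>v (?A *\<^sub>v col S j)"
      using A' S T ij by (simp add: col_mult2[of _ n n _ n] assoc_mult_mat_vec[of _ n n _ n] del: col_mult)
    also have "\<dots> = ?v" using colu[OF ij(2,3)] mult_unit_vec[OF A' ij(3)] A ij Tv by simp
    finally have "col ?B j $ i = 0" using v0[OF ij(1)] by simp
    moreover have "?B $$ (i, j) = col ?B j $ i" using ij A' S T dn by (subst index_col) auto
    ultimately show ?thesis by simp
  qed
  ultimately show ?thesis using that by blast
qed

lemma similar_mat_transpose:
  fixes A :: "'a :: comm_ring_1 mat"
  assumes "similar_mat A B"
  shows "similar_mat (transpose_mat A) (transpose_mat B)"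
proof -
  obtain P Q where w: "similar_mat_wit A B P Q" using assms unfolding similar_mat_def by blast
  define n where "n = dim_row A"
  note w = similar_mat_witD[OF n_def w]
  show ?thesis
  proof (rule similar_matI[of _ _ "transpose_mat Q" "transpose_mat P" n])
    show "transpose_mat Q * transpose_mat P = 1\<^sub>m n"
      using transpose_mult[OF w(6,7)] w by simp
    show "transpose_mat P * transpose_mat Q = 1\<^sub>m n"
      using transpose_mult[OF w(7,6)] w by simp
    show "transpose_mat A = transpose_mat Q * transpose_mat B * transpose_mat P"
      unfolding w(3) using w
      by (simp add: transpose_mult[of _ n n _ n] assoc_mult_mat[of _ n n _ n _ n])
  qed (use w in auto)
qed

text \<open>
  Let \<open>d\<close> be the largest length of a chain for matrices similar to \<open>A\<close> or to its transpose. By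
  maximality and \<open>shift_form_extend\<close>, all chains of length \<open>d\<close> span invariant subspaces. This holds
  for the given matrix \<open>B\<close> and also for the matrix \<open>C\<close> that \<open>shift_form_dual\<close> makes of it. Thus
  both off-diagonal blocks of \<open>C\<close> vanish, and \<open>C\<close> is the direct sum of a companion matrix and a
  smaller matrix.
\<close>

lemma power_clean_if_companions:
  fixes A :: "'a :: field mat"
  assumes "A \<in> carrier_mat n n"
    and "\<And>d c. 0 < d \<Longrightarrow> d \<le> n \<Longrightarrow> power_clean m (companion d c :: 'a mat)"
  shows "power_clean m A"
  using assms
proof (induction n arbitrary: A rule: less_induct)
  case (less n)
  note A = less.prems(1)
  show ?case
  proof (cases "n = 0")
    case True
    thus ?thesis using A by (intro power_cleanI[of "1\<^sub>m 0" 0 "1\<^sub>m 0"]) auto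
  next
    case False
    define F where "F d \<longleftrightarrow> 0 < d \<and> (\<exists>B \<in> carrier_mat n n. shift_form d B
       \<and> (similar_mat B A \<or> similar_mat B (transpose_mat A)))" for d
    have "F 1" unfolding F_def
      using A False by (auto simp: shift_form_def intro!: bexI[of _ A] similar_mat_refl)
    moreover have bound: "d \<le> n" if "F d" for d using that by (auto simp: F_def shift_form_def)
    ultimately obtain d where Fd: "F d" and max: "\<And>k. F k \<Longrightarrow> k \<le> d"
      using Greatest_le_nat[of F _ n] GreatestI_nat[of F 1 n] by metis
    have d: "0 < d" "d \<le> n" using Fd bound by (auto simp: F_def)
    have full: "C $$ (i, j) = 0"
      if C: "C \<in> carrier_mat n n" "shift_form d C" "similar_mat C A \<or> similar_mat C (transpose_mat A)"
         "d \<le> i" "i < n" "j < d" for C i j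
    proof (cases "Suc j < d")
      case True thus ?thesis using that by (auto simp: shift_form_def)
    next
      case False
      hence j: "j = d - 1" using that by simp
      show ?thesis
      proof (rule ccontr)
        assume "C $$ (i, j) \<noteq> 0"
        then obtain D where "similar_mat D C" "D \<in> carrier_mat n n" "shift_form (Suc d) D"
          using shift_form_extend[OF C(1,2) d(1) C(4,5)] j by blast
        hence "F (Suc d)" using C(3) unfolding F_def by (blast intro: similar_mat_trans)
        thus False using max by fastforce
      qed
    qed
    obtain B where B: "B \<in> carrier_mat n n" "shift_form d B"
      "similar_mat B A \<or> similar_mat B (transpose_mat A)" using Fd unfolding F_def by blast
    obtain C where C: "similar_mat C (transpose_mat B)" "C \<in> carrier_mat n n" "shift_form d C"
      and right: "\<And>i j. i < d \<Longrightarrow> d \<le> j \<Longrightarrow> j < n \<Longrightarrow> C $$ (i, j) = 0"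
      using shift_form_dual[OF B(1,2) d(1) full[OF B]] by blast
    have simC: "similar_mat C A \<or> similar_mat C (transpose_mat A)"
      using B(3) C(1) similar_mat_transpose transpose_transpose similar_mat_trans by metis
    define l where "l = n - d"
    define Y where "Y = mat l l (\<lambda>(i, j). C $$ (i + d, j + d))"
    have Y: "Y \<in> carrier_mat l l" by (simp add: Y_def)
    have blocks: "C = four_block_mat (companion d (\<lambda>i. C $$ (i, d - 1))) (0\<^sub>m d l) (0\<^sub>m l d) Y"
    proof (rule eq_matI)
      fix i j assume "i < dim_row (four_block_mat (companion d (\<lambda>i. C $$ (i, d - 1))) (0\<^sub>m d l) (0\<^sub>m l d) Y)"
        "j < dim_col (four_block_mat (companion d (\<lambda>i. C $$ (i, d - 1))) (0\<^sub>m d l) (0\<^sub>m l d) Y)"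
      hence ij: "i < n" "j < n" using d by (auto simp: companion_def Y_def l_def)
      consider "i < d" "Suc j < d" | "i < d" "Suc j = d" | "i < d" "d \<le> j" | "d \<le> i" "j < d" | "d \<le> i" "d \<le> j"
        by linarith
      thus "C $$ (i, j) = four_block_mat (companion d (\<lambda>i. C $$ (i, d - 1))) (0\<^sub>m d l) (0\<^sub>m l d) Y $$ (i, j)"
        by cases (use ij C(2,3) d right[of i j] full[OF C(2,3) simC, of i j] in
          \<open>auto simp: companion_def Y_def l_def shift_form_def\<close>)
    qed (use C d in \<open>auto simp: companion_def Y_def l_def\<close>)
    have "power_clean m Y"
      by (rule less.IH[OF _ Y less.prems(2)]) (use d in \<open>auto simp: l_def\<close>)
    hence "power_clean m C"
      using power_clean_block_diag[OF companion_carrier less.prems(2)[OF d] Y] blocks by metis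
    hence "power_clean m A \<or> power_clean m (transpose_mat A)"
      using simC power_clean_similar similar_mat_sym by metis
    thus ?thesis using power_clean_transpose[of "transpose_mat A" n m] A by auto
  qed
qed

section \<open>Multiplication by \<open>X\<close> modulo a polynomial\<close>

lemma idempotent_if_identity_columns:
  fixes E :: "'a :: semiring_1 mat"
  assumes E: "E \<in> carrier_mat d d"
    and left: "\<And>i j. i < d \<Longrightarrow> j < h \<Longrightarrow> j < d \<Longrightarrow> E $$ (i, j) = 0"
    and corner: "\<And>i j. h \<le> i \<Longrightarrow> i < d \<Longrightarrow> h \<le> j \<Longrightarrow> j < d \<Longrightarrow> E $$ (i, j) = (if i = j then 1 else 0)"
  shows "E * E = E"
proof (rule eq_matI)
  fix i j assume "i < dim_row E" "j < dim_col E"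
  hence ij: "i < d" "j < d" using E by auto
  have "(E * E) $$ (i, j) = (\<Sum>k = 0..<d. E $$ (i, k) * E $$ (k, j))"
    using E ij by (simp add: scalar_prod_def)
  also have "\<dots> = (\<Sum>k = 0..<d. if k = j then E $$ (i, j) else 0)"
  proof (rule sum.cong[OF refl])
    fix k assume "k \<in> {0..<d}"
    thus "E $$ (i, k) * E $$ (k, j) = (if k = j then E $$ (i, j) else 0)"
      using left[of i k] left[of k j] left[of i j] corner[of k j] ij
      by (cases "k < h"; cases "j < h") auto
  qed
  finally show "(E * E) $$ (i, j) = E $$ (i, j)" using ij by simp
qed (use E in auto)

text \<open>
  The hypothesis \<open>step\<close> says that \<open>U\<close> is the matrix of multiplication by \<open>X\<close> on polynomials modulo
  \<open>q\<close> in the basis \<open>b\<close>. As \<open>q\<close> divides \<open>X\<^sup>n - 1\<close>, multiplication by \<open>X\<^sup>n\<close> is the identity there. The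
  basis is left open because matrices similar to a companion matrix are needed, too.
\<close>

lemma pow_eq_one_if_multiplication_by_X:
  fixes U :: "'a :: field mat" and q :: "'a poly"
  assumes U: "U \<in> carrier_mat d d" and q: "q dvd monom 1 n - 1" "degree q = d"
    and b: "\<And>j. j < d \<Longrightarrow> degree (b j) = j" "\<And>j. j < d \<Longrightarrow> b j \<noteq> 0"
    and step: "\<And>j. j < d \<Longrightarrow> q dvd (\<Sum>i<d. smult (U $$ (i, j)) (b i)) - monom 1 1 * b j"
  shows "U ^\<^sub>m n = 1\<^sub>m d"
proof -
  define \<phi> where "\<phi> v = (\<Sum>j<d. smult (v $ j) (b j))" for v
  have coeff_\<phi>: "coeff (\<phi> v) k = (\<Sum>j<d. v $ j * coeff (b j) k)" for v k
    by (simp add: \<phi>_def coeff_sum)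
  have high: "coeff (\<phi> v) k = 0" if "d \<le> k" for v k
    unfolding coeff_\<phi> using that b(1) by (intro sum.neutral) (auto intro!: coeff_eq_0)
  \<comment> \<open>\<open>b\<close> is a basis: in a nontrivial combination the term of highest degree survives\<close>
  have inj: "v = 0\<^sub>v d" if v: "v \<in> carrier_vec d" and 0: "q dvd \<phi> v" for v
  proof (rule ccontr)
    assume "v \<noteq> 0\<^sub>v d"
    hence ne: "{j. j < d \<and> v $ j \<noteq> 0} \<noteq> {}" using v by (auto intro: eq_vecI)
    define m where "m = Max {j. j < d \<and> v $ j \<noteq> 0}"
    have m: "m < d" "v $ m \<noteq> 0" using Max_in[OF _ ne] by (auto simp: m_def)
    have max: "v $ j = 0" if "m < j" "j < d" for j
      using Max_ge[of "{j. j < d \<and> v $ j \<noteq> 0}" j] that unfolding m_def[symmetric] by fastforce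
    have "coeff (\<phi> v) m = (\<Sum>j<d. if j = m then v $ m * coeff (b m) m else 0)"
      unfolding coeff_\<phi>
    proof (rule sum.cong[OF refl])
      fix j assume "j \<in> {..<d}"
      thus "v $ j * coeff (b j) m = (if j = m then v $ m * coeff (b m) m else 0)"
        using max[of j] b(1)[of j] coeff_eq_0[of "b j" m] by (cases j m rule: linorder_cases) auto
    qed
    also have "\<dots> = v $ m * lead_coeff (b m)" using m b by simp
    finally have "coeff (\<phi> v) m \<noteq> 0" using m b(2) by simp
    hence nz: "\<phi> v \<noteq> 0" by auto
    have "d \<le> degree (\<phi> v)" using dvd_imp_degree_le[OF 0 nz] q by simp
    from high[OF this, of v] show False using nz by simp
  qed
  have \<phi>_U: "q dvd \<phi> (U *\<^sub>v v) - monom 1 1 * \<phi> v" if v: "v \<in> carrier_vec d" for v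
  proof -
    have "\<phi> (U *\<^sub>v v) = (\<Sum>i<d. \<Sum>j<d. smult (v $ j) (smult (U $$ (i, j)) (b i)))"
      unfolding \<phi>_def
    proof (rule sum.cong[OF refl])
      fix i assume "i \<in> {..<d}"
      hence "(U *\<^sub>v v) $ i = (\<Sum>j<d. v $ j * U $$ (i, j))"
        using U v by (simp add: scalar_prod_def lessThan_atLeast0 mult.commute)
      thus "smult ((U *\<^sub>v v) $ i) (b i) = (\<Sum>j<d. smult (v $ j) (smult (U $$ (i, j)) (b i)))"
        by (simp add: smult_sum)
    qed
    also have "\<dots> = (\<Sum>j<d. smult (v $ j) (\<Sum>i<d. smult (U $$ (i, j)) (b i)))"
      by (subst sum.swap) (simp add: smult_sum2)
    finally have "\<phi> (U *\<^sub>v v) - monom 1 1 * \<phi> v =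
        (\<Sum>j<d. smult (v $ j) ((\<Sum>i<d. smult (U $$ (i, j)) (b i)) - monom 1 1 * b j))"
      by (simp add: \<phi>_def smult_diff_right sum_subtractf sum_distrib_left)
    thus ?thesis using step by (auto intro!: dvd_sum dvd_smult)
  qed
  have \<phi>_pow: "q dvd \<phi> (U ^\<^sub>m k *\<^sub>v v) - monom 1 k * \<phi> v" if v: "v \<in> carrier_vec d" for v k
  proof (induction k)
    case 0 show ?case using U v by (simp flip: one_pCons add: monom_0)
  next
    case (Suc k)
    let ?w = "U ^\<^sub>m k *\<^sub>v v"
    have w: "?w \<in> carrier_vec d" using U v by (auto intro!: carrier_vecI)
    have "U ^\<^sub>m Suc k *\<^sub>v v = U *\<^sub>v ?w"
      unfolding pow_mat_Suc_left[OF U] using U v by (simp add: assoc_mult_mat_vec[of _ d d _ d])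
    moreover have "monom 1 (Suc k) = monom 1 1 * (monom 1 k :: 'a poly)" by (simp add: mult_monom)
    hence "\<phi> (U *\<^sub>v ?w) - monom 1 (Suc k) * \<phi> v =
        (\<phi> (U *\<^sub>v ?w) - monom 1 1 * \<phi> ?w) + monom 1 1 * (\<phi> ?w - monom 1 k * \<phi> v)"
      by (simp add: algebra_simps)
    ultimately show ?case using \<phi>_U[OF w] Suc
      by (simp only: dvd_add dvd_mult)
  qed
  have fixed: "U ^\<^sub>m n *\<^sub>v v = v" if v: "v \<in> carrier_vec d" for v
  proof -
    let ?w = "U ^\<^sub>m n *\<^sub>v v"
    have w: "?w \<in> carrier_vec d" using U v by (auto intro!: carrier_vecI)
    have "\<phi> (?w - v) = \<phi> ?w - \<phi> v"
      using v w by (simp add: \<phi>_def smult_diff_left sum_subtractf)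
    also have "\<dots> = (\<phi> ?w - monom 1 n * \<phi> v) + (monom 1 n - 1) * \<phi> v" by (simp add: algebra_simps)
    finally have "q dvd \<phi> (?w - v)" using \<phi>_pow[OF v] q(1) by simp
    hence "?w - v = 0\<^sub>v d" using inj v w by simp
    hence "(?w - v) $ i = 0" if "i < d" for i using that by simp
    thus ?thesis using U v w by (intro eq_vecI) auto
  qed
  show ?thesis
  proof (rule eq_matI)
    fix i j assume ij: "i < dim_row (1\<^sub>m d :: 'a mat)" "j < dim_col (1\<^sub>m d :: 'a mat)"
    have "col (U ^\<^sub>m n) j = unit_vec d j"
      using fixed[of "unit_vec d j"] mult_unit_vec[of "U ^\<^sub>m n" d d j] U ij by simp
    hence "col (U ^\<^sub>m n) j $ i = unit_vec d j $ i" by simp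
    thus "(U ^\<^sub>m n) $$ (i, j) = 1\<^sub>m d $$ (i, j)" using U ij by simp
  qed (use U in auto)
qed

lemma companion_pow_eq_one:
  fixes f :: "'a :: field poly"
  assumes "f dvd monom 1 n - 1" "degree f = d" "lead_coeff f = 1"
  shows "companion d (\<lambda>i. - coeff f i) ^\<^sub>m n = 1\<^sub>m d"
proof (rule pow_eq_one_if_multiplication_by_X[OF companion_carrier assms(1,2)])
  fix j assume j: "j < d"
  show "degree (monom (1 :: 'a) j) = j" "monom (1 :: 'a) j \<noteq> 0" by (simp_all add: degree_monom_eq)
  let ?s = "\<Sum>i<d. smult (companion d (\<lambda>i. - coeff f i) $$ (i, j)) (monom 1 i)"
  have s: "coeff ?s k = (if k < d then companion d (\<lambda>i. - coeff f i) $$ (k, j) else 0)" for k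
    by (simp add: coeff_sum coeff_monom if_distrib[of "(*) _"] cong: if_cong)
  show "f dvd ?s - monom 1 1 * monom 1 j"
  proof (cases "Suc j = d")
    case True
    have "?s - monom 1 1 * monom 1 j = - f"
    proof (rule poly_eqI)
      fix k
      have "coeff f k = 0" if "k > d" using that assms coeff_eq_0 by blast
      thus "coeff (?s - monom 1 1 * monom 1 j) k = coeff (- f) k"
        unfolding coeff_diff s using True assms
        by (cases k d rule: linorder_cases) (auto simp: companion_def mult_monom)
    qed
    thus ?thesis by simp
  next
    case False
    have "?s - monom 1 1 * monom 1 j = 0"
    proof (rule poly_eqI)
      fix k
      show "coeff (?s - monom 1 1 * monom 1 j) k = coeff 0 k"
        unfolding coeff_diff s using False j
        by (auto simp: companion_def mult_monom)
    qed
    thus ?thesis by simp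
  qed
qed

section \<open>Companion matrices over the field with two elements\<close>

lemma F2_cases: fixes x :: F2 obtains "x = 0" | "x = 1"
proof -
  have "x = 0 \<or> x = 1" by transfer auto
  thus ?thesis using that by blast
qed

lemma F2_add_self[simp]: "(x :: F2) + x = 0"
proof -
  have "(1 :: F2) + 1 = 0" using of_nat_card_eq_0[where 'a = bool] by simp
  thus ?thesis by (cases x rule: F2_cases) auto
qed

lemma F2_uminus[simp]: "- (x :: F2) = x"
  by (rule minus_unique[OF F2_add_self])

lemma F2_diff[simp]: "(x :: F2) - y = x + y"
  by (metis F2_uminus diff_conv_add_uminus)

lemma F2_add_left_self[simp]: "(x :: F2) + (x + y) = y"
  by (simp flip: add.assoc)

lemma F2_lead_coeff: "f \<noteq> 0 \<Longrightarrow> lead_coeff (f :: F2 poly) = 1"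
  by (metis F2_cases leading_coeff_0_iff)

lemma companion_difference_idempotent:
  fixes c :: "nat \<Rightarrow> F2"
  assumes "0 < d" "c (d - 1) \<noteq> c' (d - 1)"
  shows "(companion d c + companion d c') * (companion d c + companion d c') = companion d c + companion d c'"
proof (rule idempotent_if_identity_columns[where d = d and h = "d - 1"])
  fix i j assume ij: "d - 1 \<le> i" "i < d" "d - 1 \<le> j" "j < d"
  have "c (d - 1) + c' (d - 1) = 1"
    using assms(2) by (cases "c (d - 1)" rule: F2_cases; cases "c' (d - 1)" rule: F2_cases) auto
  moreover have "i = d - 1" "j = d - 1" using ij by auto
  ultimately show "(companion d c + companion d c') $$ (i, j) = (if i = j then 1 else 0)"
    using assms(1) by (auto simp: companion_def)
qed (auto simp: companion_def)

text \<open>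
  The matrix \<open>U\<close> is multiplication by \<open>X\<close> modulo \<open>f\<close> in the basis of the powers of \<open>X\<close>, except that
  the last basis element is \<open>X\<^bsup>m+2\<^esup> + X\<^bsup>m+1\<^esup> + \<beta> X\<^bsup>m\<^esup>\<close>. This choice gives the last but one column of
  \<open>U\<close> an extra \<open>1\<close> on the diagonal and an extra \<open>\<beta>\<close> above it. In the last column, the entry on the
  diagonal must differ from that of the companion matrix by \<open>1\<close>, which is where equality of the
  traces enters; the entry above it must agree with that of the companion matrix, and this
  determines \<open>\<beta>\<close>. The other entries of the column may be anything. So the difference is zero
  outside the last two columns, with an identity block in the lower right corner.
\<close>

lemma power_clean_companion_equal_trace:
  fixes c :: "nat \<Rightarrow> F2" and f :: "F2 poly"
  assumes f: "f dvd monom 1 n - 1" "degree f = m + 3" and tr: "c (m + 2) = coeff f (m + 2)"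
  shows "power_clean n (companion (m + 3) c)"
proof -
  have lead: "coeff f (m + 3) = 1" using F2_lead_coeff[of f] f(2) by fastforce
  have f_high: "coeff f k = 0" if "k > m + 3" for k using that f(2) coeff_eq_0 by metis
  define t where "t = c (m + 2) + 1"
  define \<beta> where "\<beta> = c (m + 1) + t + coeff f (m + 1)"
  define u where "u i = (if i < m then coeff f i else if i = m then coeff f m + t * \<beta>
     else if i = m + 1 then c (m + 1) else t)" for i
  define U where "U = mat (m + 3) (m + 3) (\<lambda>(i, j). if j = m + 2 then u i
     else if j = m + 1 then (if i < m then 0 else if i = m then \<beta> else 1)
     else if i = Suc j then 1 else 0)"
  define b where "b j = (if j = m + 2 then monom 1 (m + 2) + monom 1 (m + 1) + monom \<beta> m else monom (1 :: F2) j)" for j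
  have U: "U \<in> carrier_mat (m + 3) (m + 3)" by (simp add: U_def)
  have b_top: "degree (b (m + 2)) = m + 2"
  proof (rule antisym)
    show "degree (b (m + 2)) \<le> m + 2" by (rule degree_le) (auto simp: b_def)
    show "m + 2 \<le> degree (b (m + 2))" by (rule le_degree) (auto simp: b_def)
  qed
  have "U ^\<^sub>m n = 1\<^sub>m (m + 3)"
  proof (rule pow_eq_one_if_multiplication_by_X[OF U f])
    fix j assume j: "j < m + 3"
    show deg: "degree (b j) = j" using b_top j by (cases "j = m + 2") (auto simp: b_def degree_monom_eq)
    have "coeff (b j) j = 1" by (auto simp: b_def)
    thus "b j \<noteq> 0" by auto
    define s where "s = (\<Sum>i<m + 3. smult (U $$ (i, j)) (b i))"
    have "{..<m + 3} = insert (m + 2) {..<m + 2}" by auto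
    hence "s = smult (U $$ (m + 2, j)) (b (m + 2)) + (\<Sum>i<m + 2. monom (U $$ (i, j)) i)"
      by (simp add: s_def b_def smult_monom)
    hence s: "coeff s k = U $$ (m + 2, j) * coeff (b (m + 2)) k + (if k < m + 2 then U $$ (k, j) else 0)" for k
      by (simp add: coeff_sum)
    have diff: "coeff (s - monom 1 1 * b j) k = coeff s k + (if k = 0 then 0 else coeff (b j) (k - 1))" for k
      by (simp add: coeff_monom_mult)
    show "f dvd s - monom 1 1 * b j"
    proof (cases "j = m + 2")
      case True
      have "s - monom 1 1 * b j = f"
      proof (rule poly_eqI)
        fix k
        consider "k < m" | "k = m" | "k = m + 1" | "k = m + 2" | "k = m + 3" | "k > m + 3" by linarith
        thus "coeff (s - monom 1 1 * b j) k = coeff f k"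
          unfolding diff by cases (use lead tr f_high in \<open>auto simp: s True b_def U_def u_def t_def \<beta>_def algebra_simps\<close>)
      qed
      thus ?thesis by simp
    next
      case False
      have "s - monom 1 1 * b j = 0"
      proof (rule poly_eqI)
        fix k
        consider "k < m" | "k = m" | "k = m + 1" | "k = m + 2" | "k > m + 2" by linarith
        thus "coeff (s - monom 1 1 * b j) k = coeff 0 k"
          unfolding diff by cases (use j False in \<open>auto simp: s b_def U_def\<close>)
      qed
      thus ?thesis by simp
    qed
  qed
  moreover have "(companion (m + 3) c + U) * (companion (m + 3) c + U) = companion (m + 3) c + U"
  proof (rule idempotent_if_identity_columns[where d = "m + 3" and h = "m + 1"])
    fix i j assume "m + 1 \<le> i" "i < m + 3" "m + 1 \<le> j" "j < m + 3"
    hence "i = m + 1 \<or> i = m + 2" "j = m + 1 \<or> j = m + 2" by auto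
    thus "(companion (m + 3) c + U) $$ (i, j) = (if i = j then 1 else 0)"
      by (auto simp: companion_def U_def u_def t_def)
  qed (auto simp: companion_def U_def)
  moreover have "companion (m + 3) c = U + (companion (m + 3) c + U)"
    by (rule eq_matI) (auto simp: companion_def U_def add.left_commute)
  ultimately show ?thesis
    by (intro power_cleanI[of U "m + 3" "companion (m + 3) c + U"]) (auto simp: U_def)
qed

lemma coeff_0_dvd_X_pow_minus_1:
  fixes f :: "F2 poly"
  assumes "0 < n" "f dvd monom 1 n - 1"
  shows "coeff f 0 = 1"
proof -
  obtain g where "monom 1 n - 1 = f * g" using assms(2) by blast
  hence "coeff f 0 * coeff g 0 = coeff (monom 1 n - 1) 0" by (simp add: coeff_mult)
  also have "\<dots> \<noteq> 0" using assms(1) by simp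
  finally have "coeff f 0 \<noteq> 0" by auto
  thus ?thesis by (cases "coeff f 0" rule: F2_cases) auto
qed

text \<open>
  In characteristic two this is the case \<open>U = 1\<close>.
\<close>

lemma power_clean_if_complement_idempotent:
  fixes A :: "F2 mat"
  assumes "A \<in> carrier_mat d d" "(A + 1\<^sub>m d) * (A + 1\<^sub>m d) = A + 1\<^sub>m d"
  shows "power_clean n A"
proof (rule power_cleanI)
  show "1\<^sub>m d ^\<^sub>m n = (1\<^sub>m d :: F2 mat)" by (induction n) auto
  show "A = 1\<^sub>m d + (A + 1\<^sub>m d)" using assms by (intro eq_matI) (auto simp: add.left_commute)
qed (use assms in auto)

text \<open>
  An idempotent of rank one or two settles everything except equal traces in size at most two. In
  that case the given companion matrix is equal to that of \<open>f\<close>, or its sum with the identity is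
  idempotent, or it is nilpotent and its sum with the identity is similar to the companion matrix
  of \<open>f\<close>.
\<close>

lemma power_clean_companion_F2:
  fixes c :: "nat \<Rightarrow> F2" and f :: "F2 poly"
  assumes n: "0 < n" and d: "0 < d" and f: "f dvd monom 1 n - 1" "degree f = d"
  shows "power_clean n (companion d c)"
proof -
  have "lead_coeff f = 1" using F2_lead_coeff[of f] f d by fastforce
  hence pow: "companion d (coeff f) ^\<^sub>m n = 1\<^sub>m d" using companion_pow_eq_one[OF f] by simp
  have eq: "companion d c = companion d c' + (companion d c + companion d c')" for c'
    by (rule eq_matI) (auto simp: companion_def add.left_commute)
  consider (ne) "c (d - 1) \<noteq> coeff f (d - 1)" | (one) "d = 1"
    | (two) "d = 2" "c 1 = coeff f 1" | (more) m where "d = m + 3" "c (m + 2) = coeff f (m + 2)"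
  proof (cases "c (d - 1) = coeff f (d - 1)")
    case True
    have "d = 1 \<or> d = 2 \<or> d = (d - 3) + 3" using d by linarith
    then consider "d = 1" | "d = 2" | m where "d = m + 3" by blast
    thus ?thesis using True that by cases auto
  qed (use that in blast)
  thus ?thesis
  proof cases
    case ne
    show ?thesis
      by (rule power_cleanI[OF _ _ pow companion_difference_idempotent[where c = c and c' = "coeff f", OF d ne] eq]) auto
  next
    case one
    show ?thesis
    proof (rule power_clean_if_complement_idempotent[of _ d])
      show "(companion d c + 1\<^sub>m d) * (companion d c + 1\<^sub>m d) = companion d c + 1\<^sub>m d"
        by (cases "c 0" rule: F2_cases; intro eq_matI) (auto simp: one companion_def scalar_prod_def)
    qed auto
  next
    case two
    show ?thesis
    proof (cases "c 0" rule: F2_cases)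
      case 2
      \<comment> \<open>\<open>f\<close> has constant term \<open>1\<close>, so in this case both polynomials are equal\<close>
      have "companion d c = companion d (coeff f)"
        using two 2 coeff_0_dvd_X_pow_minus_1[OF n f(1)]
        by (intro eq_matI) (auto simp: companion_def less_2_cases_iff)
      thus ?thesis
        using pow by (intro power_cleanI[of "companion d c" d "0\<^sub>m d d"]) auto
    next
      case c0: 1
      show ?thesis
      proof (cases "c 1" rule: F2_cases)
        case 2
        show ?thesis
        proof (rule power_clean_if_complement_idempotent[of _ d])
          show "(companion d c + 1\<^sub>m d) * (companion d c + 1\<^sub>m d) = companion d c + 1\<^sub>m d"
            by (intro eq_matI) (auto simp: two(1) c0 2[unfolded One_nat_def] companion_def scalar_prod_def less_Suc_eq numeral_2_eq_2)
        qed auto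
      next
        case 1
        \<comment> \<open>the nilpotent block plus the identity is multiplication by \<open>X\<close> modulo \<open>(X + 1)\<^sup>2\<close> in the basis \<open>1, X + 1\<close>\<close>
        let ?U = "companion d c + 1\<^sub>m d"
        let ?b = "\<lambda>j::nat. if j = 0 then 1 else [:1, 1 :: F2:]"
        have "coeff f 2 = 1" using \<open>lead_coeff f = 1\<close> two f by simp
        moreover have "coeff f 0 = 1" "coeff f 1 = 0"
          using coeff_0_dvd_X_pow_minus_1[OF n f(1)] two(2) 1 by simp_all
        moreover have "f = [:coeff f 0, coeff f 1, coeff f 2:]"
        proof (rule poly_eqI)
          fix k
          have "k = 0 \<or> k = Suc 0 \<or> k = Suc (Suc 0) \<or> degree f < k"
            using f(2) two(1) by linarith
          moreover have "coeff [:x, y, z:] k = 0" if "2 < k" for x y z :: F2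
            by (rule coeff_eq_0) (use that in \<open>simp add: le_less_trans[OF degree_pCons_le]\<close>)
          ultimately show "coeff f k = coeff [:coeff f 0, coeff f 1, coeff f 2:] k"
            using coeff_eq_0[of f k] unfolding f(2) two(1) by (elim disjE) (simp_all add: numeral_2_eq_2)
        qed
        ultimately have "f = [:1, 0, 1:]" by metis
        have "?U ^\<^sub>m n = 1\<^sub>m d"
        proof (rule pow_eq_one_if_multiplication_by_X[OF _ f, where b = ?b])
          fix j assume "j < d"
          hence j: "j = 0 \<or> j = 1" using two by auto
          show "degree (?b j) = j" "?b j \<noteq> 0" using j by auto
          have U: "?U $$ (0, j) = (if j = 0 then 1 else 0)" "?U $$ (1, j) = 1"
            using j c0 1 two(1) by (auto simp: companion_def)
          have "{..<d} = {0, 1}" using two(1) by auto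
          hence sum: "(\<Sum>i<d. smult (?U $$ (i, j)) (?b i)) = smult (if j = 0 then 1 else 0) 1 + [:1, 1:]"
            by (simp add: U del: One_nat_def)
          have "1 + [:1, 1:] = [:0, 1 :: F2:]" "[:1, 1 :: F2:] - [:0, 1:] * [:1, 1:] = [:1, 0, 1:]"
            by (simp_all only: one_pCons add_pCons mult_pCons_left diff_pCons minus_pCons smult_pCons F2_add_self
                F2_diff F2_uminus add_0_left add_0_right mult_1 smult_0_left smult_0_right mult_zero_left diff_0 minus_zero)
          hence "(\<Sum>i<d. smult (?U $$ (i, j)) (?b i)) - monom 1 1 * ?b j = (if j = 0 then 0 else f)"
            unfolding sum using j by (elim disjE) (simp_all add: \<open>f = [:1, 0, 1:]\<close> monom_altdef)
          thus "f dvd (\<Sum>i<d. smult (?U $$ (i, j)) (?b i)) - monom 1 1 * ?b j" by simp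
        qed auto
        thus ?thesis
          by (intro power_cleanI[of ?U d "1\<^sub>m d"]) (auto intro!: eq_matI simp: companion_def add.assoc)
      qed
    qed
  next
    case more
    thus ?thesis using power_clean_companion_equal_trace[of f n m c] f by simp
  qed
qed

section \<open>Every matrix over the field with two elements is 16-power clean\<close>

lemma pow_mat_add:
  assumes "A \<in> carrier_mat n n"
  shows "A ^\<^sub>m (k + l) = A ^\<^sub>m k * A ^\<^sub>m l"
proof (induction l)
  case (Suc l)
  thus ?case using assms by (simp add: assoc_mult_mat[of _ n n _ n _ n])
qed (use assms in auto)

lemma pow_mat_eq_one_mult:
  assumes "A \<in> carrier_mat n n" "A ^\<^sub>m k = 1\<^sub>m n"
  shows "A ^\<^sub>m (k * l) = 1\<^sub>m n"
proof (induction l)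
  case (Suc l)
  have "A ^\<^sub>m (k * Suc l) = A ^\<^sub>m (k + k * l)" by simp
  also have "\<dots> = 1\<^sub>m n" unfolding pow_mat_add[OF assms(1)] assms(2) Suc by simp
  finally show ?case .
qed (use assms in auto)

lemma power_clean_dvd:
  assumes A: "power_clean m A" and "m dvd n"
  shows "power_clean n A"
proof -
  obtain k where k: "n = m * k" using assms(2) by blast
  obtain U E where UE: "U \<in> carrier_mat (dim_row A) (dim_row A)"
    "E \<in> carrier_mat (dim_row A) (dim_row A)" "U ^\<^sub>m m = 1\<^sub>m (dim_row A)" "E * E = E" "A = U + E"
    using A unfolding power_clean_def by blast
  have "U ^\<^sub>m n = 1\<^sub>m (dim_row A)" unfolding k by (rule pow_mat_eq_one_mult[OF UE(1,3)])
  thus ?thesis by (rule power_cleanI[OF UE(1,2) _ UE(4,5)])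
qed

lemma pow_block_upper_triangular:
  assumes A: "A \<in> carrier_mat l l" and B: "B \<in> carrier_mat k k" and C: "C \<in> carrier_mat l k"
  shows "\<exists>C' \<in> carrier_mat l k. four_block_mat A C (0\<^sub>m k l) B ^\<^sub>m n
    = four_block_mat (A ^\<^sub>m n) C' (0\<^sub>m k l) (B ^\<^sub>m n)"
proof (induction n)
  case 0
  show ?case using A B by (intro bexI[of _ "0\<^sub>m l k"]) auto
next
  case (Suc n)
  then obtain C' where C': "C' \<in> carrier_mat l k"
    and eq: "four_block_mat A C (0\<^sub>m k l) B ^\<^sub>m n = four_block_mat (A ^\<^sub>m n) C' (0\<^sub>m k l) (B ^\<^sub>m n)" by blast
  have "four_block_mat (A ^\<^sub>m n) C' (0\<^sub>m k l) (B ^\<^sub>m n) * four_block_mat A C (0\<^sub>m k l) B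
    = four_block_mat (A ^\<^sub>m n * A) (A ^\<^sub>m n * C + C' * B) (0\<^sub>m k l) (B ^\<^sub>m n * B)"
    using A B C C' by (subst mult_four_block_mat[of _ l l _ k _ k _ _ l _ k]) auto
  thus ?case using A B C C' by (intro bexI[of _ "A ^\<^sub>m n * C + C' * B"]) (auto simp: eq)
qed

text \<open>
  The \<open>n\<close>-th power is unipotent with a single off-diagonal block, and squaring doubles that block,
  which kills it in characteristic two.
\<close>

lemma pow_block_upper_triangular_eq_one_F2:
  fixes A :: "F2 mat"
  assumes A: "A \<in> carrier_mat l l" "A ^\<^sub>m n = 1\<^sub>m l" and B: "B \<in> carrier_mat k k" "B ^\<^sub>m n = 1\<^sub>m k"
    and C: "C \<in> carrier_mat l k"
  shows "four_block_mat A C (0\<^sub>m k l) B ^\<^sub>m (2 * n) = 1\<^sub>m (l + k)"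
proof -
  let ?T = "four_block_mat A C (0\<^sub>m k l) B"
  obtain C' where C': "C' \<in> carrier_mat l k"
    and eq: "?T ^\<^sub>m n = four_block_mat (1\<^sub>m l) C' (0\<^sub>m k l) (1\<^sub>m k)"
    using pow_block_upper_triangular[OF A(1) B(1) C, of n] A B by auto
  have T: "?T \<in> carrier_mat (l + k) (l + k)" using A B by auto
  have C0: "C' + C' = 0\<^sub>m l k" using C' by (intro eq_matI) auto
  have "?T ^\<^sub>m (2 * n) = ?T ^\<^sub>m n * ?T ^\<^sub>m n" using pow_mat_add[OF T, of n n] by (simp add: mult_2)
  also have "\<dots> = four_block_mat (1\<^sub>m l) (C' + C') (0\<^sub>m k l) (1\<^sub>m k)"
    unfolding eq using C' by (subst mult_four_block_mat[of _ l l _ k _ k _ _ l _ k]) auto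
  finally show ?thesis by (simp add: C0)
qed

definition shift_mat :: "nat \<Rightarrow> F2 mat" where
  "shift_mat d = mat d d (\<lambda>(i, j). if i = Suc j then 1 else 0)"

text \<open>
  The off-diagonal block that remains when a chain of unit vectors is cut in two: it maps the last
  vector of the first part to the first vector of the second part.
\<close>

definition link_mat :: "nat \<Rightarrow> nat \<Rightarrow> F2 mat" where
  "link_mat k l = mat k l (\<lambda>(i, j). if i = 0 \<and> Suc j = l then 1 else 0)"

lemma link_mat_carrier[simp]: "link_mat k l \<in> carrier_mat k l" by (simp add: link_mat_def)

lemma mult_link_mat:
  assumes E: "E \<in> carrier_mat k k" and col0: "\<And>i. i < k \<Longrightarrow> E $$ (i, 0) = 0"
  shows "E * link_mat k l = 0\<^sub>m k l"
proof (rule eq_matI)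
  fix i j assume ij: "i < dim_row (0\<^sub>m k l :: F2 mat)" "j < dim_col (0\<^sub>m k l :: F2 mat)"
  have "(E * link_mat k l) $$ (i, j) = (\<Sum>r = 0..<k. E $$ (i, r) * link_mat k l $$ (r, j))"
    using E ij by (simp add: scalar_prod_def link_mat_def)
  also have "\<dots> = 0"
    using col0 ij by (intro sum.neutral) (auto simp: link_mat_def)
  finally show "(E * link_mat k l) $$ (i, j) = 0\<^sub>m k l $$ (i, j)" using ij by simp
qed (use E in \<open>auto simp: link_mat_def\<close>)

lemma link_mat_mult:
  assumes E: "E \<in> carrier_mat l l"
    and last: "\<And>j. j < l \<Longrightarrow> E $$ (l - 1, j) = (if Suc j = l then 1 else 0)"
  shows "link_mat k l * E = link_mat k l"
proof (rule eq_matI)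
  fix i j assume "i < dim_row (link_mat k l)" "j < dim_col (link_mat k l)"
  hence ij: "i < k" "j < l" by (simp_all add: link_mat_def)
  have "(link_mat k l * E) $$ (i, j) = (\<Sum>r = 0..<l. link_mat k l $$ (i, r) * E $$ (r, j))"
    using E ij by (simp add: scalar_prod_def link_mat_def)
  also have "\<dots> = (\<Sum>r = 0..<l. if r = l - 1 then (if i = 0 then E $$ (l - 1, j) else 0) else 0)"
    using ij by (intro sum.cong) (auto simp: link_mat_def)
  also have "\<dots> = link_mat k l $$ (i, j)"
    using last[of j] ij by (auto simp: link_mat_def)
  finally show "(link_mat k l * E) $$ (i, j) = link_mat k l $$ (i, j)" .
qed (use E in \<open>auto simp: link_mat_def\<close>)

text \<open>
  The idempotent absorbs the link between two pieces of a chain. This leaves the unit summand block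
  upper triangular. The condition on the last row makes \<open>E\<close> a right identity for the link, and the
  one on the first column makes \<open>F\<close> annihilate it.
\<close>

lemma idempotent_linked_blocks:
  assumes E: "E \<in> carrier_mat l l" "E * E = E"
    and last: "\<And>j. j < l \<Longrightarrow> E $$ (l - 1, j) = (if Suc j = l then 1 else 0)"
    and F: "F \<in> carrier_mat k k" "F * F = F" and col0: "\<And>i. i < k \<Longrightarrow> F $$ (i, 0) = 0"
  shows "four_block_mat E (0\<^sub>m l k) (link_mat k l) F * four_block_mat E (0\<^sub>m l k) (link_mat k l) F
    = four_block_mat E (0\<^sub>m l k) (link_mat k l) F"
proof -
  have "link_mat k l * E + F * link_mat k l = link_mat k l"
    using mult_link_mat[OF F(1) col0, of l] link_mat_mult[OF E(1) last, of k]
    by (simp add: right_add_zero_mat[OF link_mat_carrier])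
  moreover have "E * E + 0\<^sub>m l k * link_mat k l = E"
    using E by (simp add: left_mult_zero_mat[OF link_mat_carrier[of k l], of l])
  moreover have "link_mat k l * 0\<^sub>m l k + F * F = F"
    using F by (simp add: right_mult_zero_mat[OF link_mat_carrier[of k l], of k])
  moreover have "E * 0\<^sub>m l k + 0\<^sub>m l k * F = 0\<^sub>m l k" using E F by simp
  ultimately show ?thesis
    by (simp only: mult_four_block_mat[OF E(1) zero_carrier_mat link_mat_carrier F(1)
          E(1) zero_carrier_mat link_mat_carrier F(1)])
qed

text \<open>
  \<open>D\<close> is the companion matrix of \<open>X\<^sup>3 + X\<^sup>2 + X + 1 = (X + 1)\<^sup>3\<close>, a divisor of \<open>X\<^sup>4 - 1\<close>. Size three is the
  smallest that works: the trace must be odd, and the first and last index must differ so that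
  pieces can be linked.
\<close>

lemma shift_mat_decomposition_3:
  defines "D \<equiv> mat 3 3 (\<lambda>(i, j). if j = 2 \<or> i = Suc j then 1 else 0 :: F2)"
    and "E \<equiv> mat 3 3 (\<lambda>(i, j). if j = 2 then 1 else 0 :: F2)"
  shows "D ^\<^sub>m 4 = 1\<^sub>m 3" "E * E = E" "shift_mat 3 = D + E"
proof -
  have D: "D \<in> carrier_mat 3 3" by (simp add: D_def)
  have D2: "D * D = mat 3 3 (\<lambda>(i, j). if (i, j) \<in> {(2, 0), (0, 1), (1, 1), (2, 1), (0, 2)} then 1 else 0)"
    by (intro eq_matI) (auto simp: D_def scalar_prod_def eval_nat_numeral less_Suc_eq)
  have "D ^\<^sub>m 4 = (D * D) * (D * D)"
    using D by (simp add: eval_nat_numeral assoc_mult_mat[of _ 3 3 _ 3 _ 3])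
  also have "\<dots> = 1\<^sub>m 3"
    unfolding D2 by (intro eq_matI) (auto simp: scalar_prod_def eval_nat_numeral less_Suc_eq)
  finally show "D ^\<^sub>m 4 = 1\<^sub>m 3" .
  show "E * E = E"
    by (intro eq_matI) (auto simp: E_def scalar_prod_def eval_nat_numeral less_Suc_eq)
  show "shift_mat 3 = D + E"
    by (intro eq_matI) (auto simp: D_def E_def shift_mat_def eval_nat_numeral less_Suc_eq)
qed

lemma shift_mat_blocks:
  "shift_mat (l + k) = four_block_mat (shift_mat l) (0\<^sub>m l k) (link_mat k l) (shift_mat k)"
proof (rule eq_matI)
  fix i j assume "i < dim_row (four_block_mat (shift_mat l) (0\<^sub>m l k) (link_mat k l) (shift_mat k))"
    "j < dim_col (four_block_mat (shift_mat l) (0\<^sub>m l k) (link_mat k l) (shift_mat k))"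
  hence "i < l + k" "j < l + k" by (auto simp: shift_mat_def)
  thus "shift_mat (l + k) $$ (i, j)
      = four_block_mat (shift_mat l) (0\<^sub>m l k) (link_mat k l) (shift_mat k) $$ (i, j)"
    by (cases "i < l"; cases "j < l") (simp_all add: shift_mat_def link_mat_def, linarith+)
qed (simp_all add: shift_mat_def)

lemma companion_blocks:
  assumes "0 < k"
  shows "companion (l + k) c = four_block_mat (shift_mat l)
    (mat l k (\<lambda>(i, j). if Suc j = k then c i else 0)) (link_mat k l) (companion k (\<lambda>i. c (i + l)))"
    (is "_ = ?B")
proof (rule eq_matI)
  fix i j assume "i < dim_row ?B" "j < dim_col ?B"
  hence "i < l + k" "j < l + k" by (auto simp: shift_mat_def companion_def)
  thus "companion (l + k) c $$ (i, j) = ?B $$ (i, j)"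
    using assms by (cases "i < l"; cases "j < l") (simp_all add: shift_mat_def link_mat_def companion_def, linarith+)
qed (simp_all add: shift_mat_def companion_def)

text \<open>
  \<open>D\<close> is a direct sum of blocks of size three, so its order does not grow with the size. The links
  between the blocks are part of \<open>E\<close>, and the last two clauses let further pieces be linked to
  either end.
\<close>

lemma shift_mat_decomposition:
  "\<exists>D E. D \<in> carrier_mat (3 * Suc s) (3 * Suc s) \<and> E \<in> carrier_mat (3 * Suc s) (3 * Suc s)
     \<and> D ^\<^sub>m 4 = 1\<^sub>m (3 * Suc s) \<and> E * E = E \<and> shift_mat (3 * Suc s) = D + E
     \<and> (\<forall>i < 3 * Suc s. E $$ (i, 0) = 0)
     \<and> (\<forall>j < 3 * Suc s. E $$ (3 * Suc s - 1, j) = (if Suc j = 3 * Suc s then 1 else 0))"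
proof (induction s)
  case 0
  show ?case
    using shift_mat_decomposition_3
    by (intro exI[of _ "mat 3 3 (\<lambda>(i, j). if j = 2 \<or> i = Suc j then 1 else 0)"]
        exI[of _ "mat 3 3 (\<lambda>(i, j). if j = 2 then 1 else 0)"]) auto
next
  case (Suc s)
  let ?k = "3 * Suc s"
  from Suc obtain D E where
    DE: "D \<in> carrier_mat ?k ?k" "E \<in> carrier_mat ?k ?k" "D ^\<^sub>m 4 = 1\<^sub>m ?k" "E * E = E" "shift_mat ?k = D + E"
    and col0: "\<And>i. i < ?k \<Longrightarrow> E $$ (i, 0) = 0"
    and last: "\<And>j. j < ?k \<Longrightarrow> E $$ (?k - 1, j) = (if Suc j = ?k then 1 else 0)" by blast
  define k where "k = ?k"
  note DE = DE[folded k_def] and col0 = col0[folded k_def] and last = last[folded k_def]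
  have k: "2 < k" "3 * Suc (Suc s) = 3 + k" by (auto simp: k_def)
  define D3 where "D3 = mat 3 3 (\<lambda>(i, j). if j = 2 \<or> i = Suc j then 1 else 0 :: F2)"
  define E3 where "E3 = mat 3 3 (\<lambda>(i, j). if j = 2 then 1 else 0 :: F2)"
  note three = shift_mat_decomposition_3[folded D3_def E3_def]
  have c3: "D3 \<in> carrier_mat 3 3" "E3 \<in> carrier_mat 3 3" by (auto simp: D3_def E3_def)
  let ?D = "four_block_mat D3 (0\<^sub>m 3 k) (0\<^sub>m k 3) D"
  let ?E = "four_block_mat E3 (0\<^sub>m 3 k) (link_mat k 3) E"
  have "?D ^\<^sub>m 4 = 1\<^sub>m (3 + k)" unfolding pow_four_block_mat[OF c3(1) DE(1)] three DE by simp
  moreover have "?E * ?E = ?E"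
    by (rule idempotent_linked_blocks[OF c3(2) three(2) _ DE(2,4) col0]) (auto simp: E3_def)
  moreover have "shift_mat (3 + k) = ?D + ?E"
    unfolding shift_mat_blocks three DE(5) using c3 DE
    by (subst add_four_block_mat[of _ 3 3 _ k _ k]) auto
  moreover have "?E $$ (i, 0) = 0" if "i < 3 + k" for i
    using that col0[of "i - 3"] c3 DE by (auto simp: E3_def link_mat_def)
  moreover have "?E $$ (3 + k - 1, j) = (if Suc j = 3 + k then 1 else 0)" if "j < 3 + k" for j
  proof -
    have "3 + k - 1 - 3 = k - 1" "\<not> 3 + k - 1 < 3" using k by auto
    thus ?thesis using that last[of "j - 3"] c3 DE k by (auto simp: link_mat_def)
  qed
  moreover have "?D \<in> carrier_mat (3 + k) (3 + k)" "?E \<in> carrier_mat (3 + k) (3 + k)" using c3 DE by auto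
  ultimately show ?case unfolding k(2) by blast
qed

lemma F2_poly_X_plus_1_pow: "([:1, 1:] :: F2 poly) ^ (2 ^ k) = monom 1 (2 ^ k) - 1"
proof -
  have "([:1, 1:] :: F2 poly) = monom 1 1 + 1"
    by (rule poly_eqI) (auto simp: coeff_pCons split: nat.splits)
  hence "([:1, 1:] :: F2 poly) ^ (2 ^ k) = monom 1 1 ^ (2 ^ k) + 1 ^ (2 ^ k)"
    using add_power_prime_poly_mod_ring[of "monom 1 1 :: F2 poly" 1 k] by simp
  also have "\<dots> = monom 1 (2 ^ k) + 1" by (simp add: monom_power)
  also have "\<dots> = monom 1 (2 ^ k) - 1" by (rule poly_eqI) simp
  finally show ?thesis .
qed

lemma degree_X_plus_1_pow: "degree ([:1, 1:] ^ k :: F2 poly) = k"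
  by (simp add: degree_power_eq)

lemma coeff_X_plus_1_pow: "coeff ([:1, 1:] ^ Suc k :: F2 poly) k = of_nat (Suc k)"
proof (induction k)
  case (Suc k)
  let ?p = "[:1, 1:] ^ Suc k :: F2 poly"
  have "coeff ?p (Suc k) = 1"
    using F2_lead_coeff[of ?p] degree_X_plus_1_pow[of "Suc k"] by (metis degree_0 nat.distinct(1))
  moreover have "[:1, 1:] ^ Suc (Suc k) = ?p + pCons 0 ?p" by simp
  hence "coeff ([:1, 1:] ^ Suc (Suc k)) (Suc k) = coeff ?p (Suc k) + coeff ?p k"
    by (simp only: coeff_add coeff_pCons_Suc)
  ultimately show ?case using Suc by (simp only: of_nat_Suc)
qed simp

text \<open>
  The last piece of a large companion matrix gets a power of \<open>X + 1\<close> as its polynomial. Its size \<open>a\<close>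
  is determined modulo three, and its trace is the parity of \<open>a\<close>; moving one block of size three to
  the last piece changes this parity.
\<close>

lemma exists_unipotent_factor:
  fixes t :: F2
  assumes "8 \<le> d"
  obtains a s f where "d = 3 * Suc s + a" "2 \<le> a" "degree f = a" "f dvd monom 1 8 - 1" "coeff f (a - 1) \<noteq> t"
proof -
  obtain a s where a: "d = 3 * Suc s + (a + 3)" "2 \<le> a" "a \<le> 4"
  proof -
    obtain e where e: "d = 8 + e" using assms le_Suc_ex by blast
    obtain q r where "e = 3 * q + r" "r < 3"
      using mult_div_mod_eq[of 3 e] mod_less_divisor[of 3 e] by (metis zero_less_numeral)
    thus ?thesis using that[of q "r + 2"] e by simp
  qed
  have dvd: "[:1, 1:] ^ k dvd (monom 1 8 - 1 :: F2 poly)" if "k \<le> 8" for k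
    using F2_poly_X_plus_1_pow[of 3] le_imp_power_dvd[OF that, of "[:1, 1:] :: F2 poly"] by simp
  have sub: "coeff ([:1, 1:] ^ k :: F2 poly) (k - 1) = of_nat k" if "0 < k" for k
    using coeff_X_plus_1_pow[of "k - 1"] that by (simp del: power_Suc)
  have "(of_nat (a + 3) :: F2) = of_nat a + 1"
    by (simp add: eval_nat_numeral add.assoc)
  hence "(of_nat a :: F2) \<noteq> t \<or> (of_nat (a + 3) :: F2) \<noteq> t" by auto
  thus ?thesis
  proof
    assume t: "of_nat a \<noteq> t"
    have "coeff ([:1, 1:] ^ a) (a - 1) \<noteq> t" using t sub[of a] a(2) by auto
    thus ?thesis using that[of "Suc s" a, OF _ a(2) degree_X_plus_1_pow dvd] a by simp
  next
    assume t: "of_nat (a + 3) \<noteq> t"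
    have "coeff ([:1, 1:] ^ (a + 3)) (a + 3 - 1) \<noteq> t" using t sub[of "a + 3"] by simp
    thus ?thesis using that[of s "a + 3", OF a(1) _ degree_X_plus_1_pow dvd] a by simp
  qed
qed

text \<open>
  For large \<open>d\<close> the unit summand has the two diagonal blocks \<open>D\<close> and \<open>?V\<close>, of orders dividing \<open>4\<close>
  and \<open>8\<close>, and above \<open>?V\<close> the remaining entries \<open>?X\<close> of the last column. One more squaring absorbs
  \<open>?X\<close> and leads to the exponent \<open>16\<close>.
\<close>

lemma power_clean_16_companion:
  fixes c :: "nat \<Rightarrow> F2"
  assumes d: "0 < d"
  shows "power_clean 16 (companion d c)"
proof (cases "d < 8")
  case True
  have "[:1, 1:] ^ d dvd (monom 1 16 - 1 :: F2 poly)"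
    using F2_poly_X_plus_1_pow[of 4] le_imp_power_dvd[of d 16 "[:1, 1:] :: F2 poly"] True by simp
  from power_clean_companion_F2[OF _ d this degree_X_plus_1_pow] show ?thesis by simp
next
  case False
  then obtain a s f where dec: "d = 3 * Suc s + a" "2 \<le> a"
    and f: "degree f = a" "f dvd monom 1 8 - 1" "coeff f (a - 1) \<noteq> c (d - 1)"
    using exists_unipotent_factor[of d "c (d - 1)"] by (metis not_less)
  define l where "l = 3 * Suc s"
  have d': "d = l + a" using dec by (simp add: l_def)
  obtain D E where
    DE: "D \<in> carrier_mat l l" "E \<in> carrier_mat l l" "D ^\<^sub>m 4 = 1\<^sub>m l" "E * E = E" "shift_mat l = D + E"
    and last: "\<And>j. j < l \<Longrightarrow> E $$ (l - 1, j) = (if Suc j = l then 1 else 0)"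
    using shift_mat_decomposition[of s] unfolding l_def by blast
  define c' where "c' = (\<lambda>i. c (i + l))"
  let ?V = "companion a (coeff f)" and ?F = "companion a c' + companion a (coeff f)"
  let ?X = "mat l a (\<lambda>(i, j). if Suc j = a then c i else 0)"
  have "lead_coeff f = 1" using F2_lead_coeff[of f] f dec by fastforce
  hence V: "?V ^\<^sub>m 8 = 1\<^sub>m a" using companion_pow_eq_one[OF f(2,1)] by simp
  have F: "?F * ?F = ?F"
    by (rule companion_difference_idempotent) (use dec f(3) in \<open>auto simp: c'_def d' add.commute\<close>)
  have D8: "D ^\<^sub>m 8 = 1\<^sub>m l" using pow_mat_eq_one_mult[OF DE(1,3), of 2] by simp
  let ?U = "four_block_mat D ?X (0\<^sub>m a l) ?V" and ?E = "four_block_mat E (0\<^sub>m l a) (link_mat a l) ?F"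
  show ?thesis
  proof (rule power_cleanI)
    show "?U \<in> carrier_mat (l + a) (l + a)" "?E \<in> carrier_mat (l + a) (l + a)" using DE by auto
    show "?U ^\<^sub>m 16 = 1\<^sub>m (l + a)"
      using pow_block_upper_triangular_eq_one_F2[OF DE(1) D8 companion_carrier V, of ?X] by simp
    show "?E * ?E = ?E"
      by (rule idempotent_linked_blocks[OF DE(2,4) last _ F]) (use dec in \<open>auto simp: companion_def\<close>)
    have eq: "companion a c' = ?V + ?F" by (intro eq_matI) (auto simp: companion_def add.left_commute)
    show "companion d c = ?U + ?E"
      unfolding d' companion_blocks[OF order.strict_trans2[OF pos2 dec(2)]] DE(5) c'_def[symmetric]
      using DE by (subst add_four_block_mat[of _ l l _ a _ a]) (auto simp: eq[symmetric])
  qed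
qed

section \<open>A gap in the degrees of divisors\<close>

text \<open>
  Modulo \<open>g\<close> the order of \<open>X\<close> divides both exponents, hence it is one.
\<close>

lemma dvd_X_minus_1_if_coprime_exponents:
  fixes g :: "'a :: field poly"
  assumes g: "g dvd monom 1 a - 1" "g dvd monom 1 b - 1" and ab: "gcd a b = 1" "0 < a"
  shows "g dvd monom 1 1 - 1"
proof -
  have pow: "g dvd monom 1 (e * k) - 1" if "g dvd monom 1 e - 1" for e k :: nat
  proof -
    have "(monom 1 e :: 'a poly) - 1 dvd (monom 1 e) ^ k - 1 ^ k"
      by (metis power_diff_sumr2 dvd_triv_left)
    thus ?thesis using that by (auto simp: monom_power intro: dvd_trans)
  qed
  obtain x y where xy: "a * x = b * y + 1"
    using bezout_nat[of a b] ab by auto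
  have "monom 1 1 - 1 = (monom 1 (a * x) - 1) - monom 1 1 * (monom 1 (b * y) - 1 :: 'a poly)"
    unfolding xy by (simp add: algebra_simps mult_monom)
  thus ?thesis using pow[OF g(1), of x] pow[OF g(2), of y] by (metis dvd_diff dvd_mult)
qed

text \<open>
  This is the irreducibility of the nineteenth cyclotomic polynomial. An irreducible factor of degree
  \<open>k\<close> divides \<open>X\<^sup>l - 1\<close> for \<open>l = 2\<^sup>k - 1\<close> as well as for \<open>l = 19\<close>. For \<open>0 < k < 18\<close> these exponents are
  coprime, so the factor would have to be \<open>X - 1\<close>; but the value of the cyclotomic polynomial
  at \<open>1\<close> is \<open>19\<close>, which is odd.
\<close>

lemma Phi19_factors:
  fixes g :: "F2 poly"
  assumes g: "g dvd (\<Sum>i<19. monom 1 i)" "0 < degree g"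
  shows "18 \<le> degree g"
proof (rule ccontr)
  assume small: "\<not> 18 \<le> degree g"
  have "g \<noteq> 0" "\<not> is_unit g" using g(2) by (auto simp: is_unit_iff_degree)
  then obtain p where p: "prime p" "p dvd g" using prime_divisor_exists by blast
  from p(1) have irr: "irreducible p" by (rule prime_elem_imp_irreducible[OF prime_imp_prime_elem])
  define k where "k = degree p"
  have "k \<le> degree g" unfolding k_def using p(2) \<open>g \<noteq> 0\<close> by (rule dvd_imp_degree_le)
  hence k: "0 < k" "k < 18"
    using small irr by (auto simp: k_def irreducible_def is_unit_iff_degree)
  have sum: "monom 1 19 - 1 = (monom 1 1 - 1) * (\<Sum>i<19. monom 1 i :: F2 poly)"
    using power_diff_1_eq[of "monom 1 1 :: F2 poly" 19] by (simp add: monom_power)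
  have p19: "p dvd monom 1 19 - 1" unfolding sum using p(2) g(1) by (meson dvd_mult dvd_trans)
  have "p dvd monom 1 1 ^ (2 ^ k) - monom 1 1" using degree_divisor1[OF irr k_def[symmetric]] by simp
  also have "monom 1 1 ^ (2 ^ k) - monom 1 1 = monom 1 1 * (monom 1 (2 ^ k - 1) - 1 :: F2 poly)"
    by (simp add: monom_power algebra_simps mult_monom)
  finally have "p dvd monom 1 1 \<or> p dvd monom 1 (2 ^ k - 1) - 1"
    using p(1) prime_dvd_mult_iff by blast
  moreover have "\<not> p dvd monom 1 1"
  proof
    assume "p dvd monom 1 1"
    hence "p dvd monom 1 1 * monom 1 18 - (monom 1 19 - 1)" using p19 by (meson dvd_diff dvd_mult2)
    hence "p dvd 1" by (simp add: mult_monom)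
    thus False using p(1) not_prime_unit by blast
  qed
  ultimately have pk: "p dvd monom 1 (2 ^ k - 1) - 1" by blast
  have "k \<in> {1, 2, 3, 4, 5, 6, 7, 8, 9, 10, 11, 12, 13, 14, 15, 16, 17}"
    using k by (simp only: insert_iff empty_iff) arith
  hence "gcd 19 (2 ^ k - 1 :: nat) = 1" by (elim insertE) (simp_all add: gcd_non_0_nat)
  hence X1: "p dvd monom 1 1 - 1" using dvd_X_minus_1_if_coprime_exponents[OF p19 pk] by simp
  \<comment> \<open>modulo \<open>X - 1\<close> the sum of the nineteen powers of \<open>X\<close> is \<open>19 = 1\<close>\<close>
  have "p dvd monom 1 i - 1" for i
  proof -
    have "(monom 1 1 :: F2 poly) - 1 dvd monom 1 1 ^ i - 1 ^ i" by (metis power_diff_sumr2 dvd_triv_left)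
    thus ?thesis using X1 by (auto simp: monom_power intro: dvd_trans)
  qed
  hence "p dvd (\<Sum>i<19::nat. monom 1 i - 1)" by (rule dvd_sum)
  hence "p dvd (\<Sum>i<19. monom 1 i) - (\<Sum>i<19::nat. monom 1 i - 1)"
    by (rule dvd_diff[OF dvd_trans[OF p(2) g(1)]])
  also have "(\<Sum>i<19. monom 1 i) - (\<Sum>i<19::nat. monom 1 i - 1) = (of_nat 19 :: F2 poly)"
    by (simp add: sum_subtractf)
  also have "(of_nat 19 :: F2 poly) = (1 + 1) * of_nat 9 + 1" by simp
  also have "(1 + 1 :: F2 poly) = 0" by (rule poly_eqI) (simp only: coeff_add F2_add_self coeff_0)
  finally have "p dvd 1" by simp
  thus False using p(1) not_prime_unit by blast
qed

text \<open>
  A divisor of degree \<open>17\<close> is too small to share a factor with \<open>\<Psi>\<close>, and too large to divide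
  \<open>(X + 1)\<^sup>1\<^sup>6\<close>.
\<close>

lemma no_divisor_of_degree_17:
  fixes f :: "F2 poly"
  assumes f: "f dvd monom 1 304 - 1"
  shows "degree f \<noteq> 17"
proof
  assume deg: "degree f = 17"
  define \<Psi> where "\<Psi> = (\<Sum>i<19. monom 1 i :: F2 poly)"
  have "monom 1 304 - 1 = (monom 1 19 - 1 :: F2 poly) ^ 16"
  proof -
    have minus: "p - 1 = p + 1" for p :: "F2 poly" by (rule poly_eqI) simp
    have "(monom 1 19 + 1 :: F2 poly) ^ CARD(bool) ^ 4 = monom 1 19 ^ CARD(bool) ^ 4 + 1 ^ CARD(bool) ^ 4"
      by (rule add_power_prime_poly_mod_ring)
    thus ?thesis unfolding minus by (simp add: monom_power)
  qed
  also have "monom 1 19 - 1 = (monom 1 1 - 1) * \<Psi>"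
    using power_diff_1_eq[of "monom 1 1 :: F2 poly" 19] by (simp add: monom_power \<Psi>_def)
  also have "monom 1 1 - 1 = [:1, 1 :: F2:]"
    by (rule poly_eqI) (auto simp: coeff_pCons split: nat.splits)
  finally have dvd: "f dvd [:1, 1:] ^ 16 * \<Psi> ^ 16" using f by (simp only: power_mult_distrib)
  have "algebraic_semidom_class.coprime f \<Psi>"
  proof (rule algebraic_semidom_class.coprimeI)
    fix g assume g: "g dvd f" "g dvd \<Psi>"
    have "f \<noteq> 0" using deg by auto
    hence "degree g \<le> 17" "g \<noteq> 0" using dvd_imp_degree_le[OF g(1)] g(1) deg by auto
    hence "degree g = 0" using Phi19_factors[of g] g(2) by (cases "degree g") (simp_all add: \<Psi>_def)
    thus "is_unit g" using \<open>g \<noteq> 0\<close> by (simp add: is_unit_iff_degree)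
  qed
  hence "f dvd [:1, 1:] ^ 16" using dvd by (simp add: coprime_dvd_mult_left_iff)
  hence "degree f \<le> 16" using dvd_imp_degree_le[of f "[:1, 1:] ^ 16"] degree_X_plus_1_pow[of 16] by simp
  thus False using deg by simp
qed

section \<open>Almost torsion clean matrix rings\<close>

lemma almost_torsion_clean_mat:
  fixes A :: "'a :: field mat"
  assumes "0 < m" "0 < n" and clean: "\<And>A :: 'a mat. A \<in> carrier_mat n n \<Longrightarrow> power_clean m A"
  shows "almost_torsion_clean m (ring_mat TYPE('a) n ())"
proof -
  let ?R = "ring_mat TYPE('a) n ()"
  interpret ring ?R by (rule ring_mat)
  have "\<exists>u \<in> Units ?R. \<exists>e \<in> carrier ?R. u [^]\<^bsub>?R\<^esub> m = \<one>\<^bsub>?R\<^esub> \<and> e \<otimes>\<^bsub>?R\<^esub> e = e \<and> r = u \<oplus>\<^bsub>?R\<^esub> e"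
    if r: "r \<in> carrier ?R" for r
  proof -
    have "r \<in> carrier_mat n n" using r by (simp add: ring_mat_simps)
    then obtain U E where UE: "U \<in> carrier_mat n n" "E \<in> carrier_mat n n" "U ^\<^sub>m m = 1\<^sub>m n" "E * E = E" "r = U + E"
      using power_cleanE[OF clean] by metis
    have pow: "U [^]\<^bsub>?R\<^esub> m = \<one>\<^bsub>?R\<^esub>" using pow_mat_ring_pow[OF UE(1), of m "()"] UE(3) by (simp add: ring_mat_simps)
    have "U ^\<^sub>m (m - 1) * U = 1\<^sub>m n" "U * U ^\<^sub>m (m - 1) = 1\<^sub>m n"
      using pow_mat_Suc_left[OF UE(1), of "m - 1"] UE(3) assms(1) by (cases m; simp)+
    hence "U \<in> Units ?R" using UE(1) unfolding Units_def by (auto simp: ring_mat_simps intro!: bexI[of _ "U ^\<^sub>m (m - 1)"])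
    thus ?thesis using UE pow by (auto simp: ring_mat_simps)
  qed
  moreover have "\<one>\<^bsub>?R\<^esub> \<noteq> \<zero>\<^bsub>?R\<^esub>"
  proof
    assume "\<one>\<^bsub>?R\<^esub> = \<zero>\<^bsub>?R\<^esub>"
    hence "(1\<^sub>m n :: 'a mat) $$ (0, 0) = 0\<^sub>m n n $$ (0, 0)" by (simp add: ring_mat_simps)
    thus False using assms(2) by simp
  qed
  ultimately show ?thesis unfolding almost_torsion_clean_def using assms(1) ring_axioms by blast
qed

theorem theorem2p8:
  shows "(\<forall>n::nat. n > 2 \<longrightarrow> p_practical TYPE(bool) n \<longrightarrow>
            almost_torsion_clean n (ring_mat TYPE(F2) n ()))
       \<and> (\<exists>n::nat. n > 2 \<and> almost_torsion_clean n (ring_mat TYPE(F2) n ())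
            \<and> \<not> p_practical TYPE(bool) n)"
proof (intro conjI allI impI)
  fix n :: nat assume n: "n > 2" and pr: "p_practical TYPE(bool) n"
  show "almost_torsion_clean n (ring_mat TYPE(F2) n ())"
  proof (rule almost_torsion_clean_mat)
    fix A :: "F2 mat" assume A: "A \<in> carrier_mat n n"
    show "power_clean n A"
    proof (rule power_clean_if_companions[OF A])
      fix d and c :: "nat \<Rightarrow> F2" assume d: "0 < d" "d \<le> n"
      then obtain f :: "F2 poly" where "f dvd monom 1 n - 1" "degree f = d"
        using pr unfolding p_practical_def by blast
      thus "power_clean n (companion d c)" using power_clean_companion_F2 n d by simp
    qed
  qed (use n in auto)
next
  have "almost_torsion_clean 304 (ring_mat TYPE(F2) 304 ())"
  proof (rule almost_torsion_clean_mat)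
    fix A :: "F2 mat" assume A: "A \<in> carrier_mat 304 304"
    show "power_clean 304 A"
      by (rule power_clean_dvd[OF power_clean_if_companions[OF A power_clean_16_companion]]) auto
  qed auto
  moreover have "\<not> p_practical TYPE(bool) 304"
  proof
    assume "p_practical TYPE(bool) 304"
    hence "\<forall>d\<le>304. \<exists>f :: F2 poly. f dvd monom 1 304 - 1 \<and> degree f = d"
      unfolding p_practical_def by simp
    hence "\<exists>f :: F2 poly. f dvd monom 1 304 - 1 \<and> degree f = 17" by (rule allE[of _ 17]) simp
    thus False using no_divisor_of_degree_17 by blast
  qed
  ultimately show "\<exists>n::nat. n > 2 \<and> almost_torsion_clean n (ring_mat TYPE(F2) n ())
      \<and> \<not> p_practical TYPE(bool) n"
    by (intro exI[of _ 304]) simp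
qed

end
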